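(* Let $a,b,n$ be positive integers with $ab$ odd and $4\mid a-b$. Then $$t(a,2a,b,2b;n)=N(a,2a,b,2b;8n+3(a+b))-N\big(a,2a,b,2b;4n+\tfrac{3(a+b)}2\big).$$
   Context: For positive integers $a_1,\dots,a_k$ and a nonnegative integer $n$, $N(a_1,\dots,a_k;n)$ is the number of $(x_1,\dots,x_k)\in\mathbb Z^k$ with $n=a_1x_1^2+\cdots+a_kx_k^2$, and $t(a_1,\dots,a_k;n)$ is the number of $(x_1,\dots,x_k)\in\mathbb Z^k$ with $n=a_1\frac{x_1(x_1-1)}2+\cdots+a_k\frac{x_k(x_k-1)}2$. *)

theory Defs
  imports Main
begin

text \<open>
  Both counts are meant for lists of positive coefficients, where the solution sets are finite
  and \<^const>\<open>card\<close> is the true number of solutions.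
\<close>

definition repN :: "nat list \<Rightarrow> nat \<Rightarrow> nat" where
  "repN as n = card {xs :: int list. length xs = length as \<and>
     int n = (\<Sum>i<length as. int (as ! i) * (xs ! i)\<^sup>2)}"

text \<open>The integer division by 2 is exact, since \<open>x (x - 1)\<close> is always even.\<close>

definition rept :: "nat list \<Rightarrow> nat \<Rightarrow> nat" where
  "rept as n = card {xs :: int list. length xs = length as \<and>
     int n = (\<Sum>i<length as. int (as ! i) * ((xs ! i) * (xs ! i - 1) div 2))}"

end

theory Submission
  imports Defs
begin

text \<open>
  Completing the square, the left-hand side counts the solutions of
  \<open>a x\<^sup>2 + 2 a y\<^sup>2 + b z\<^sup>2 + 2 b w\<^sup>2 = 8 n + 3 (a + b)\<close> with all four variables odd.
  In any solution \<open>x\<close> and \<open>z\<close> have the same parity. If both are odd, then reduction modulo 8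
  forces \<open>y\<close> and \<open>w\<close> to be odd. If both are even, say \<open>x = 2 y'\<close> and \<open>z = 2 w'\<close>, then halving
  the equation shows that \<open>(y, y', w, w')\<close> is a solution of the same equation with
  right-hand side \<open>4 n + 3 (a + b) / 2\<close>, and conversely.
\<close>

text \<open>Passes from lists to quadruples, on which the bijections and case distinctions below can
  pattern match.\<close>

lemma card_lists_length_4:
  "card {xs :: 'a list. length xs = 4 \<and> P (xs ! 0) (xs ! 1) (xs ! 2) (xs ! 3)} =
   card {(x, y, z, w). P x y z w}"
proof (rule sym, rule bij_betw_same_card)
  show "bij_betw (\<lambda>(x, y, z, w). [x, y, z, w]) {(x, y, z, w). P x y z w}
          {xs. length xs = 4 \<and> P (xs ! 0) (xs ! 1) (xs ! 2) (xs ! 3)}"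
  proof (rule bij_betw_byWitness[where f' = "\<lambda>xs. (xs ! 0, xs ! 1, xs ! 2, xs ! 3)"])
    show "\<forall>xs \<in> {xs :: 'a list. length xs = 4 \<and> P (xs ! 0) (xs ! 1) (xs ! 2) (xs ! 3)}.
        (case (xs ! 0, xs ! 1, xs ! 2, xs ! 3) of (x, y, z, w) \<Rightarrow> [x, y, z, w]) = xs"
      by (auto simp: numeral_eq_Suc length_Suc_conv)
  qed (auto simp: numeral_eq_Suc)
qed

lemma repN_4:
  "repN [p, q, r, s] n = card {(x, y, z, w).
     int n = int p * x\<^sup>2 + int q * y\<^sup>2 + int r * z\<^sup>2 + int s * w\<^sup>2}"
  unfolding repN_def card_lists_length_4[symmetric]
  by (simp add: numeral_eq_Suc lessThan_Suc algebra_simps)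

lemma rept_4:
  "rept [p, q, r, s] n = card {(x, y, z, w).
     int n = int p * (x * (x - 1) div 2) + int q * (y * (y - 1) div 2)
           + int r * (z * (z - 1) div 2) + int s * (w * (w - 1) div 2)}"
  unfolding rept_def card_lists_length_4[symmetric]
  by (simp add: numeral_eq_Suc lessThan_Suc algebra_simps)

lemma eight_triangular: "8 * (x * (x - 1) div 2) = (2 * x - 1)\<^sup>2 - (1 :: int)"
proof -
  have "2 * (x * (x - 1) div 2) = x * (x - 1)"
    by (intro dvd_mult_div_cancel) auto
  then have "8 * (x * (x - 1) div 2) = 4 * (x * (x - 1))"
    by linarith
  then show ?thesis
    by (simp only:) (simp add: power2_eq_square algebra_simps)
qed

text \<open>Multiply the equation by 8 and complete each square via \<open>eight_triangular\<close>;
  the four constants 1 contribute \<open>p + q + r + s\<close>. The substitution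
  \<open>2 * x - 1\<close> maps the integers bijectively onto the odd ones.\<close>

lemma rept_4_eq_card_odd:
  "rept [p, q, r, s] n = card {(x, y, z, w). odd x \<and> odd y \<and> odd z \<and> odd w \<and>
     int (8 * n + (p + q + r + s)) = int p * x\<^sup>2 + int q * y\<^sup>2 + int r * z\<^sup>2 + int s * w\<^sup>2}"
proof -
  have iff: "int n = int p * (x * (x - 1) div 2) + int q * (y * (y - 1) div 2)
           + int r * (z * (z - 1) div 2) + int s * (w * (w - 1) div 2) \<longleftrightarrow>
        int (8 * n + (p + q + r + s)) = int p * (2 * x - 1)\<^sup>2 + int q * (2 * y - 1)\<^sup>2
           + int r * (2 * z - 1)\<^sup>2 + int s * (2 * w - 1)\<^sup>2" for x y z w
  proof -
    have sq: "(2 * u - 1)\<^sup>2 = 8 * (u * (u - 1) div 2) + (1 :: int)" for u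
      using eight_triangular[of u] by simp
    show ?thesis
      unfolding sq by (simp add: algebra_simps) linarith
  qed
  \<comment> \<open>For odd \<open>u\<close> the left side equals
    \<open>2 * ((u + 1) div 2) - 1\<close>, so this is the inverse law for the witness
    \<open>f'\<close> below.\<close>
  have odd_conv: "1 + 2 * (u div 2) = u" if "odd u" for u :: int
    using that by presburger
  show ?thesis
    unfolding rept_4 iff
    by (rule bij_betw_same_card[where f = "\<lambda>(x, y, z, w). (2 * x - 1, 2 * y - 1, 2 * z - 1, 2 * w - 1)"],
        rule bij_betw_byWitness[where f' = "\<lambda>(x, y, z, w).
          ((x + 1) div 2, (y + 1) div 2, (z + 1) div 2, (w + 1) div 2)"])
       (auto simp: odd_conv)
qed

text \<open>Every term is nonnegative and bounds the absolute value of its variable, so all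
  solutions lie in a box. Finiteness is what makes \<open>card\<close> additive on the disjoint
  union in the theorem.\<close>

lemma finite_diagonal_quaternary:
  assumes "p > 0" "q > 0" "r > 0" "s > 0"
  shows "finite {(x, y, z, w).
     int n = int p * x\<^sup>2 + int q * y\<^sup>2 + int r * z\<^sup>2 + int s * w\<^sup>2}"
proof (rule finite_subset)
  let ?I = "{- int n .. int n}"
  have term_bound: "\<bar>x\<bar> \<le> int k * x\<^sup>2" if "k > 0" for k :: nat and x :: int
  proof -
    have "\<bar>x\<bar> \<le> \<bar>x\<bar> * \<bar>x\<bar>"
      by (cases "x = 0") (use mult_left_mono[of 1 "\<bar>x\<bar>" "\<bar>x\<bar>"] in auto)
    also have "\<dots> = 1 * x\<^sup>2"
      by (simp add: power2_eq_square)
    also have "\<dots> \<le> int k * x\<^sup>2"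
      using that by (intro mult_right_mono) auto
    finally show ?thesis .
  qed
  show "{(x, y, z, w). int n = int p * x\<^sup>2 + int q * y\<^sup>2 + int r * z\<^sup>2 + int s * w\<^sup>2}
          \<subseteq> ?I \<times> ?I \<times> ?I \<times> ?I"
  proof
    fix v
    assume "v \<in> {(x, y, z, w). int n = int p * x\<^sup>2 + int q * y\<^sup>2 + int r * z\<^sup>2 + int s * w\<^sup>2}"
    then obtain x y z w where "v = (x, y, z, w)"
      "int n = int p * x\<^sup>2 + int q * y\<^sup>2 + int r * z\<^sup>2 + int s * w\<^sup>2"
      by auto
    then show "v \<in> ?I \<times> ?I \<times> ?I \<times> ?I"
      using term_bound[OF assms(1), of x] term_bound[OF assms(2), of y]
        term_bound[OF assms(3), of z] term_bound[OF assms(4), of w]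
      by auto
  qed
qed simp

lemma odd_square_mod_8:
  assumes "odd (x :: int)"
  obtains k where "x\<^sup>2 = 8 * k + 1"
proof -
  define m where "m = (x + 1) div 2"
  have "x = 2 * m - 1"
    unfolding m_def using assms by presburger
  then have "x\<^sup>2 = 8 * (m * (m - 1) div 2) + 1"
    using eight_triangular[of m] by simp
  then show thesis
    by (rule that)
qed

lemma odd_variables:
  fixes a b n x y z w :: int
  assumes "odd a" and "4 dvd a - b" and "odd x"
    and eq: "8 * n + 3 * (a + b) = a * x\<^sup>2 + 2 * a * y\<^sup>2 + b * z\<^sup>2 + 2 * b * w\<^sup>2"
  shows "odd y \<and> odd z \<and> odd w"
proof -
  obtain c where "a - b = 4 * (- c)"
    using assms(2) by (metis dvdE minus_minus)
  then have b: "b = a + 4 * c"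
    by simp
  have "even (8 * n + 3 * (a + b))"
    by (simp add: b)
  then have "even (a * x\<^sup>2 + 2 * a * y\<^sup>2 + b * z\<^sup>2 + 2 * b * w\<^sup>2)"
    unfolding eq .
  then have z: "odd z"
    using assms(1,3) b by simp
  obtain i where i: "x\<^sup>2 = 8 * i + 1"
    using \<open>odd x\<close> by (rule odd_square_mod_8)
  obtain j where j: "z\<^sup>2 = 8 * j + 1"
    using z by (rule odd_square_mod_8)
  \<comment> \<open>This is \<open>eq\<close> after substituting for \<open>x\<^sup>2\<close>,
    \<open>z\<^sup>2\<close> and \<open>b = a + 4 * c\<close>, then halving. The congruence of
    \<open>a\<close> and \<open>b\<close> modulo 4 is what gives \<open>y\<^sup>2\<close> and
    \<open>w\<^sup>2\<close> the common odd coefficient \<open>a\<close>, which cancels modulo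
    4.\<close>
  have "a * (y\<^sup>2 + w\<^sup>2 - 2) = 4 * (n + c - a * i - b * j - c * w\<^sup>2)"
    using eq by (simp add: i j b algebra_simps)
  then have "4 dvd a * (y\<^sup>2 + w\<^sup>2 - 2)"
    by simp
  moreover have "coprime 4 a"
    using assms(1) coprime_power_left_iff[of 2 2 a] by simp
  ultimately have four: "4 dvd y\<^sup>2 + w\<^sup>2 - 2"
    by (simp add: coprime_dvd_mult_right_iff)
  have sq: "u\<^sup>2 mod 4 = (if even u then 0 else 1)" for u :: int
  proof (cases "even u")
    case True
    then show ?thesis
      by (auto elim!: evenE simp: power_mult_distrib)
  next
    case False
    then obtain k where "u\<^sup>2 = 8 * k + 1"
      by (rule odd_square_mod_8)
    then have "u\<^sup>2 mod 4 = 1"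
      by presburger
    with False show ?thesis
      by simp
  qed
  \<comment> \<open>Squares are 0 or 1 modulo 4, so a sum of 2 forces both to be 1.\<close>
  have "(y\<^sup>2 mod 4 + w\<^sup>2 mod 4) mod 4 = 2"
    using four by presburger
  then show ?thesis
    using z sq[of y] sq[of w] by (auto split: if_splits)
qed

theorem theorem5p14:
  fixes a b n :: nat
  assumes "a > 0" and "b > 0" and "n > 0"
    and "odd (a * b)"
    and "(4::int) dvd int a - int b"
  shows "int (rept [a, 2 * a, b, 2 * b] n) =
    int (repN [a, 2 * a, b, 2 * b] (8 * n + 3 * (a + b)))
    - int (repN [a, 2 * a, b, 2 * b] (4 * n + 3 * (a + b) div 2))"
proof -
  define M where "M = 8 * n + 3 * (a + b)"
  define m where "m = 4 * n + 3 * (a + b) div 2"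
  define sols where "sols m = {(x, y, z, w).
    int m = int a * x\<^sup>2 + int (2 * a) * y\<^sup>2 + int b * z\<^sup>2 + int (2 * b) * w\<^sup>2}" for m
  define odd_sols where "odd_sols = {(x, y, z, w). odd x \<and> odd y \<and> odd z \<and> odd w \<and>
    int M = int a * x\<^sup>2 + int (2 * a) * y\<^sup>2 + int b * z\<^sup>2 + int (2 * b) * w\<^sup>2}"
  \<comment> \<open>Since \<open>a * (2 * y)\<^sup>2 + 2 * a * x\<^sup>2 = 2 * (a * x\<^sup>2 + 2 *
    a * y\<^sup>2)\<close>, and likewise for \<open>b\<close>, this map doubles the value of the
    form: it swaps the roles of the coefficients \<open>a\<close> and \<open>2 * a\<close>.\<close>
  define double :: "int \<times> int \<times> int \<times> int \<Rightarrow> int \<times> int \<times> int \<times> int"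
    where "double = (\<lambda>(x, y, z, w). (2 * y, x, 2 * w, z))"
  have odd: "odd a" "odd b"
    using assms(4) by auto
  \<comment> \<open>The division by 2 in \<open>m\<close> is exact because \<open>a + b\<close> is
    even.\<close>
  have M: "M = 2 * m"
    unfolding M_def m_def using odd by simp
  have "sols M = odd_sols \<union> double ` sols m"
  proof (intro subset_antisym subsetI)
    fix v
    assume v: "v \<in> sols M"
    obtain x y z w where v_eq: "v = (x, y, z, w)"
      by (cases v)
    have eq: "8 * int n + 3 * (int a + int b) =
        int a * x\<^sup>2 + 2 * int a * y\<^sup>2 + int b * z\<^sup>2 + 2 * int b * w\<^sup>2"
      using v by (simp add: v_eq sols_def M_def)
    show "v \<in> odd_sols \<union> double ` sols m"
    proof (cases "odd x")
      case True
      then show ?thesis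
        using odd_variables[OF _ assms(5) True eq] odd v
        by (simp add: v_eq sols_def odd_sols_def)
    next
      case False
      have "even (int a * x\<^sup>2 + 2 * int a * y\<^sup>2 + int b * z\<^sup>2 + 2 * int b * w\<^sup>2)"
        unfolding eq[symmetric] using odd by simp
      then have "even z"
        using False odd by simp
      then obtain x' z' where "x = 2 * x'" "z = 2 * z'"
        using False by (auto elim!: evenE)
      moreover from this have "(y, x', w, z') \<in> sols m"
        using v by (simp add: v_eq sols_def M power_mult_distrib)
      ultimately show ?thesis
        unfolding v_eq double_def by force
    qed
  next
    fix v
    assume "v \<in> odd_sols \<union> double ` sols m"
    then show "v \<in> sols M"
      by (auto simp: sols_def odd_sols_def double_def M power_mult_distrib)
  qed
  \<comment> \<open>The first coordinate is odd on one side and even on the other.\<close>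
  moreover have "odd_sols \<inter> double ` sols m = {}"
    by (auto simp: odd_sols_def double_def)
  moreover have "finite (sols M)"
    unfolding sols_def using assms by (intro finite_diagonal_quaternary) auto
  ultimately have "card (sols M) = card odd_sols + card (double ` sols m)"
    by (simp add: card_Un_disjoint)
  moreover have "card (double ` sols m) = card (sols m)"
    by (intro card_image) (auto simp: inj_on_def double_def)
  moreover have "rept [a, 2 * a, b, 2 * b] n = card odd_sols"
  proof -
    have "a + 2 * a + b + 2 * b = 3 * (a + b)"
      by simp
    then show ?thesis
      unfolding rept_4_eq_card_odd odd_sols_def M_def by (simp only:)
  qed
  ultimately show ?thesis
    unfolding repN_4 sols_def[symmetric] M_def[symmetric] m_def[symmetric] by simp
qed

end
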